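(* Let $1<b\le\infty$, let $\psi\in\Psi(b)$, and let $f:X\to\mathbb{R}$ be a measurable function with $f\in G(\psi)$. For $q\ge 1$ and $p\in(1,b)$ put $$ \nu(q,p)=\psi(p)\cdot\inf_{\{n(\cdot)\}\in Z}\left\{\|f\|_{G(\psi)}+32\sum_{k=1}^{\infty}\left[n(k+1)\right]^{1/p-1/q}\,\omega^{(G(\psi))}\!\left(f,\tfrac{1}{n(k)}\right)\right\}, \qquad \theta(q)=\inf_{p\in(1,b)}\nu(q,p). $$ Assume that for some $b_1\ge b$ the function $\theta(q)$ is finite for all $q\in(1,b_1)$. Then $$ |f|_q\le 6\,\theta(q)\qquad\text{for all } q\in(1,b_1), $$ or, equivalently, $\|f\|_{G(\theta)}\le 6$, where $\|f\|_{G(\theta)}=\sup_{q\in(1,b_1)}|f|_q/\theta(q)$.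
   Context: $X=[0,2\pi]$ is endowed with the normalized Lebesgue measure $\mu(A)=(2\pi)^{-1}\int_A dx$. For $p\ge 1$ and measurable $f:X\to\mathbb{R}$, $|f|_p=\left(\int_X|f|^p\,d\mu\right)^{1/p}$. For $1<b\le\infty$, $\Psi(b)=\Psi(1,b)$ denotes the set of all continuous positive functions $\psi=\psi(p)$, $p\in(1,b)$, such that the limits $\psi(1+0)$ and $\psi(b-0)$ exist (finite or not), $\inf_{p\in(1,b)}\psi(p)>0$ and $\min\{\psi(1+0),\psi(b-0)\}>0$. The Bilateral Grand Lebesgue Space $G(\psi)$ is the space of all measurable functions $f:X\to\mathbb{R}$ with finite norm $$\|f\|_{G(\psi)}=\sup_{p\in(1,b)}\frac{|f|_p}{\psi(p)}.$$ For $h\in(-2\pi,2\pi)$ the shift operator is $T(h)f(x)=f(x+h)$, where arithmetic operations on the arguments of functions are understood modulo $2\pi$. The modulus of continuity of $f$ in $G(\psi)$ is $$\omega^{(G(\psi))}(f,\delta)=\sup_{h:\,|h|\le\delta}\|T(h)f-f\|_{G(\psi)},\qquad \delta\in[0,2\pi].$$ $Z$ denotes the set of all strictly increasing sequences of natural numbers $\{n(k)\}_{k\ge1}$ with $n(1)=1$ and $n(k+1)\ge n(k)+1$ for $k=1,2,\ldots$. Infinite values of the series, and hence of $\nu(q,p)$, are allowed; the constant $C/\infty$ is interpreted as $0$. *)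

theory Defs
  imports "HOL-Analysis.Analysis" "HOL-Library.Real_Mod"
begin

definition circle_measure :: "real measure" where
  "circle_measure = scale_measure (ennreal (1 / (2 * pi))) (lebesgue_on {0..2 * pi})"

text \<open>Norms take values in \<^typ>\<open>ennreal\<close>, so no integrability has to be presupposed.
  The case distinction below is needed because the library has no powers on \<^typ>\<open>ennreal\<close>.\<close>

definition Lp_norm :: "real \<Rightarrow> (real \<Rightarrow> real) \<Rightarrow> ennreal" where
  "Lp_norm p f =
     (let I = (\<integral>\<^sup>+ x. ennreal (\<bar>f x\<bar> powr p) \<partial>circle_measure)
      in if I = \<infinity> then \<infinity> else ennreal (enn2real I powr (1 / p)))"

text \<open>The set \<^term>\<open>einterval 1 b\<close> is the open interval from \<open>1\<close> to \<open>b\<close> as a set of reals,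
  with \<open>b = \<infinity>\<close> allowed. The one-sided limits may be infinite, hence are taken in \<^typ>\<open>ereal\<close>;
  the filter \<^term>\<open>at_left (b :: ereal)\<close> covers both finite and infinite \<open>b\<close>.\<close>

definition Psi :: "ereal \<Rightarrow> (real \<Rightarrow> real) set" where
  "Psi b = {\<psi>.
     continuous_on (einterval 1 b) \<psi> \<and>
     (\<forall>p\<in>einterval 1 b. 0 < \<psi> p) \<and>
     0 < (INF p\<in>einterval 1 b. \<psi> p) \<and>
     (\<exists>L1 Lb :: ereal.
        ((\<lambda>p. ereal (\<psi> p)) \<longlongrightarrow> L1) (at_right 1) \<and>
        ((\<lambda>p. ereal (\<psi> (real_of_ereal p))) \<longlongrightarrow> Lb) (at_left b) \<and>
        0 < min L1 Lb)}"

text \<open>The weight \<open>w\<close> is \<^typ>\<open>ennreal\<close>-valued since it may be infinite; division in \<^typ>\<open>ennreal\<close>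
  gives \<open>C / \<infinity> = 0\<close>, and also \<open>0 / 0 = 0\<close>.\<close>

definition gls_norm :: "ereal \<Rightarrow> (real \<Rightarrow> ennreal) \<Rightarrow> (real \<Rightarrow> real) \<Rightarrow> ennreal" where
  "gls_norm b w f = (SUP p\<in>einterval 1 b. Lp_norm p f / w p)"

definition gls :: "ereal \<Rightarrow> (real \<Rightarrow> ennreal) \<Rightarrow> (real \<Rightarrow> real) set" where
  "gls b w = {f \<in> borel_measurable circle_measure. gls_norm b w f < \<infinity>}"

definition shift :: "real \<Rightarrow> (real \<Rightarrow> real) \<Rightarrow> real \<Rightarrow> real" where
  "shift h f x = f ((x + h) rmod (2 * pi))"

definition gls_modulus :: "ereal \<Rightarrow> (real \<Rightarrow> ennreal) \<Rightarrow> (real \<Rightarrow> real) \<Rightarrow> real \<Rightarrow> ennreal" where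
  "gls_modulus b w f \<delta> =
     (SUP h\<in>{h \<in> {-2 * pi<..<2 * pi}. \<bar>h\<bar> \<le> \<delta>}. gls_norm b w (\<lambda>x. shift h f x - f x))"

text \<open>Sequences are indexed from \<open>1\<close>; the value at \<open>0\<close> is irrelevant.\<close>

definition Zseq :: "(nat \<Rightarrow> nat) set" where
  "Zseq = {n. n 1 = 1 \<and> strict_mono_on {1..} n \<and> (\<forall>k\<ge>1. n (k + 1) \<ge> n k + 1)}"

text \<open>The library's series start at index \<open>0\<close>, so the \<open>k\<close>-th summand below is the one
  belonging to index \<open>k + 1\<close>.\<close>

definition nu :: "ereal \<Rightarrow> (real \<Rightarrow> real) \<Rightarrow> (real \<Rightarrow> real) \<Rightarrow> real \<Rightarrow> real \<Rightarrow> ennreal" where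
  "nu b \<psi> f q p = ennreal (\<psi> p) *
     (INF n\<in>Zseq. gls_norm b (\<lambda>p. ennreal (\<psi> p)) f +
        32 * (\<Sum>k. ennreal (real (n (k + 2)) powr (1 / p - 1 / q)) *
                   gls_modulus b (\<lambda>p. ennreal (\<psi> p)) f (1 / real (n (k + 1)))))"

definition theta :: "ereal \<Rightarrow> (real \<Rightarrow> real) \<Rightarrow> (real \<Rightarrow> real) \<Rightarrow> real \<Rightarrow> ennreal" where
  "theta b \<psi> f q = (INF p\<in>einterval 1 b. nu b \<psi> f q p)"

end

theory Submission
  imports Defs "HOL-Probability.Probability_Measure"
begin

text \<open>Let \<open>A\<^sub>r F\<close> be the average of the periodic extension \<open>F\<close> of \<open>f\<close> over the window \<open>[x - r, x + r]\<close>, whose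
  normalised measure is \<open>r / \<pi>\<close>. By Jensen's inequality \<open>A\<^sub>r\<close> is a contraction of \<open>L\<^sub>p\<close>, moves \<open>F\<close> by at
  most the modulus of continuity at \<open>r\<close>, and is bounded from \<open>L\<^sub>p\<close> to the bounded functions with norm
  \<open>(\<pi>/r)\<close> to the power \<open>1/p\<close>; interpolating, it maps \<open>L\<^sub>p\<close> to \<open>L\<^sub>q\<close>, \<open>p < q\<close>, with norm at most
  \<open>(\<pi>/r)\<close> to the power \<open>1/p - 1/q\<close>. Averages commute, so
  \<open>A\<^sub>s F - A\<^sub>r F = A\<^sub>s (F - A\<^sub>r F) + A\<^sub>r (A\<^sub>s F - F)\<close>, and for \<open>r = 1/n(k)\<close>, \<open>s = 1/n(k+1)\<close> the
  \<open>L\<^sub>q\<close> norm of this difference is at most a constant times the \<open>k\<close>-th term of the series. Telescoping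
  bounds the averages in \<open>L\<^sub>q\<close>. They converge to \<open>F\<close> almost everywhere because the moduli are summable, and
  Fatou's lemma carries the bound over. The constants \<open>\<pi> \<le> 6\<close> and \<open>2\<pi> \<le> 6 \<cdot> 32\<close> suffice.
  For \<open>q \<le> p\<close> the norms are ordered already.\<close>

section \<open>Norms on the circle\<close>

text \<open>Convexity on the positive half-line extends to the endpoint 0 because
  \<open>s powr p\<close> is at most \<open>s\<close> for \<open>s\<close> between 0 and 1, and to
  the whole line by the triangle inequality and monotonicity of the power.\<close>

lemma convex_on_abs_powr:
  assumes "1 \<le> (p::real)"
  shows "convex_on UNIV (\<lambda>x::real. \<bar>x\<bar> powr p)"
proof (rule convex_onI)
  fix t x y :: real
  assume t: "0 < t" "t < 1"
  have conv: "((1 - t) * a + t * b) powr p \<le> (1 - t) * a powr p + t * b powr p"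
    if ab: "0 \<le> a" "0 \<le> b" for a b
  proof -
    have scale: "(s * c) powr p \<le> s * c powr p" if "0 < s" "s < 1" "0 \<le> c" for s c :: real
    proof -
      have "s powr p \<le> s powr 1" using that assms by (intro powr_mono') auto
      then have "s powr p * c powr p \<le> s * c powr p"
        using that by (intro mult_right_mono) auto
      then show ?thesis using that by (simp add: powr_mult)
    qed
    consider "a = 0" | "b = 0" | "a > 0" "b > 0" using ab by force
    then show ?thesis
    proof cases
      case 1
      then show ?thesis using scale[of t b] t ab by simp
    next
      case 2
      then show ?thesis using scale[of "1 - t" a] t ab by simp
    next
      case 3
      then show ?thesis
        using convex_onD[OF powr_convex[OF assms], of t a b] t by simp
    qed
  qed
  have "\<bar>(1 - t) * x + t * y\<bar> \<le> (1 - t) * \<bar>x\<bar> + t * \<bar>y\<bar>"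
    using t abs_triangle_ineq[of "(1 - t) * x" "t * y"] by (simp add: abs_mult)
  then have "\<bar>(1 - t) * x + t * y\<bar> powr p \<le> ((1 - t) * \<bar>x\<bar> + t * \<bar>y\<bar>) powr p"
    using assms by (intro powr_mono2) auto
  also have "\<dots> \<le> (1 - t) * \<bar>x\<bar> powr p + t * \<bar>y\<bar> powr p"
    by (rule conv) auto
  finally show "\<bar>(1 - t) *\<^sub>R x + t *\<^sub>R y\<bar> powr p \<le> (1 - t) * \<bar>x\<bar> powr p + t * \<bar>y\<bar> powr p"
    by simp
qed simp

lemma abs_le_one_plus_powr:
  assumes "1 \<le> (p::real)"
  shows "\<bar>x::real\<bar> \<le> 1 + \<bar>x\<bar> powr p"
proof (cases "\<bar>x\<bar> \<le> 1")
  case True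
  then show ?thesis by (simp add: add_increasing2)
next
  case False
  then have "\<bar>x\<bar> powr 1 \<le> \<bar>x\<bar> powr p" using assms by (intro powr_mono) auto
  then show ?thesis using False by simp
qed

text \<open>Constants are integrable on a probability space, so
  \<open>1 + \<bar>g t\<bar> powr p\<close> is an integrable majorant.\<close>

lemma (in prob_space) integrable_of_powr:
  fixes g :: "'a \<Rightarrow> real"
  assumes [measurable]: "g \<in> borel_measurable M" and p: "1 \<le> p"
    and fin: "(\<integral>\<^sup>+ t. ennreal (\<bar>g t\<bar> powr p) \<partial>M) < \<infinity>"
  shows "integrable M g"
proof -
  have "integrable M (\<lambda>t. \<bar>g t\<bar> powr p)"
    using fin by (intro integrableI_nonneg) auto
  then have "integrable M (\<lambda>t. 1 + \<bar>g t\<bar> powr p)" by auto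
  then show ?thesis
    by (rule Bochner_Integration.integrable_bound)
       (use abs_le_one_plus_powr[OF p] in \<open>auto intro!: AE_I2 simp: order_trans[OF _ abs_ge_self]\<close>)
qed

text \<open>No integrability is assumed: an infinite right-hand side leaves nothing to prove, and a
  finite one supplies what Jensen's inequality requires.\<close>

lemma (in prob_space) jensen_powr:
  fixes g :: "'a \<Rightarrow> real"
  assumes [measurable]: "g \<in> borel_measurable M" and p: "1 \<le> p"
  shows "ennreal (\<bar>\<integral>t. g t \<partial>M\<bar> powr p) \<le> (\<integral>\<^sup>+ t. ennreal (\<bar>g t\<bar> powr p) \<partial>M)"
proof (cases "(\<integral>\<^sup>+ t. ennreal (\<bar>g t\<bar> powr p) \<partial>M) < \<infinity>")
  case True
  have int: "integrable M (\<lambda>t. \<bar>g t\<bar> powr p)"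
    using True by (intro integrableI_nonneg) auto
  have "\<bar>\<integral>t. g t \<partial>M\<bar> powr p \<le> (\<integral>t. \<bar>g t\<bar> powr p \<partial>M)"
    by (rule jensens_inequality[where I = UNIV and q = "\<lambda>x. \<bar>x\<bar> powr p"])
       (use integrable_of_powr[OF assms True] int convex_on_abs_powr[OF p] in auto)
  then show ?thesis
    by (subst nn_integral_eq_integral[OF int]) (auto intro: ennreal_leI)
next
  case False
  then show ?thesis by (simp add: less_top[symmetric])
qed

text \<open>Multiplication by a positive finite constant can be undone by division. This carries a
  bound for each single exponent and each single sequence over to the infima in \<open>theta\<close>
  and \<open>nu\<close>.\<close>

lemma ennreal_le_mult_INF:
  fixes c y :: ennreal
  assumes "0 < c" "c < top" "\<And>i. i \<in> I \<Longrightarrow> y \<le> c * X i"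
  shows "y \<le> c * (INF i\<in>I. X i)"
proof -
  have c: "c * (y / c) = y"
    using assms(1,2) mult_divide_eq_ennreal[of c y]
    by (metis ennreal_times_divide less_irrefl mult.commute)
  have "y / c \<le> X i" if "i \<in> I" for i
    using assms(1,2) assms(3)[OF that]
    by (metis divide_le_posI_ennreal mult.commute)
  then have "y / c \<le> (INF i\<in>I. X i)" by (intro INF_greatest)
  then show ?thesis
    using mult_left_mono[of "y / c" _ c] c by simp
qed

section \<open>The normalised measure on the circle\<close>

lemma space_circle [simp]: "space circle_measure = {0..2*pi}"
  by (simp add: circle_measure_def space_scale_measure)

lemma sets_circle: "sets circle_measure = sets (lebesgue_on {0..2*pi})"
  by (simp add: circle_measure_def)

lemma borel_measurable_circle:
  fixes g :: "real \<Rightarrow> 'b::topological_space"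
  assumes "g \<in> borel_measurable borel"
  shows "g \<in> borel_measurable circle_measure"
proof -
  have "g \<in> borel_measurable (lebesgue_on {0..2*pi})"
    using assms by (intro measurable_restrict_space1 measurable_completion) simp
  then show ?thesis by (simp add: measurable_cong_sets[OF sets_circle refl])
qed

lemma prob_space_circle: "prob_space circle_measure"
proof
  have "emeasure circle_measure {0..2*pi} = ennreal (1 / (2*pi)) * ennreal (2*pi)"
    by (simp add: circle_measure_def emeasure_restrict_space)
  also have "\<dots> = 1" by (simp add: ennreal_mult'[symmetric])
  finally show "emeasure circle_measure (space circle_measure) = 1" by simp
qed

interpretation circle: prob_space circle_measure
  by (rule prob_space_circle)

text \<open>The identity from \<open>circle_measure\<close> to \<open>borel\<close> is measurable,
  since Borel sets are Lebesgue sets. Composing with it yields the joint measurability on which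
  Fubini's theorem relies.\<close>

lemma measurable_circle_pair:
  fixes H :: "real \<times> real \<Rightarrow> 'b::topological_space"
  assumes "sets M = sets borel" and [measurable]: "H \<in> borel_measurable (borel \<Otimes>\<^sub>M borel)"
  shows "H \<in> borel_measurable (circle_measure \<Otimes>\<^sub>M M)"
proof -
  have [measurable]: "(\<lambda>x. x) \<in> circle_measure \<rightarrow>\<^sub>M borel"
    by (rule borel_measurable_circle) simp
  have [measurable]: "(\<lambda>x. x) \<in> M \<rightarrow>\<^sub>M borel"
    by (simp add: measurable_cong_sets[OF assms(1) refl])
  have "(\<lambda>z. H (fst z, snd z)) \<in> borel_measurable (circle_measure \<Otimes>\<^sub>M M)"
    by measurable
  then show ?thesis by simp
qed

text \<open>For Borel integrands the completion leaves the integral unchanged, so the computation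
  moves to \<open>lborel\<close>, where translation invariance is at hand.\<close>

lemma nn_integral_circle:
  assumes "G \<in> borel_measurable borel"
  shows "(\<integral>\<^sup>+ x. G x \<partial>circle_measure) =
    ennreal (1 / (2*pi)) * (\<integral>\<^sup>+ x. G x * indicator {0..2*pi} x \<partial>lborel)"
proof -
  have "G \<in> borel_measurable (lebesgue_on {0..2*pi})"
    using assms by (intro measurable_restrict_space1 measurable_completion) simp
  then show ?thesis
    by (simp add: circle_measure_def nn_integral_scale_measure nn_integral_restrict_space
        nn_integral_completion)
qed

lemma AE_circle:
  assumes "AE x in lborel. x \<in> {0..2*pi} \<longrightarrow> P x"
  shows "AE x in circle_measure. P x"
proof -
  have "AE x in lebesgue_on {0..2*pi}. P x"
    using assms by (subst AE_restrict_space_iff) (auto simp: AE_completion_iff)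
  then obtain N where N: "{x \<in> space (lebesgue_on {0..2*pi}). \<not> P x} \<subseteq> N"
      "emeasure (lebesgue_on {0..2*pi}) N = 0" "N \<in> sets (lebesgue_on {0..2*pi})"
    by (rule AE_E)
  show ?thesis
    by (rule AE_I[of _ _ N]) (use N in \<open>auto simp: circle_measure_def space_scale_measure\<close>)
qed

text \<open>Taking \<open>p\<close>-th powers is monotone, and the infinite case of
  \<open>Lp_norm\<close> is settled here once; later estimates only compare the integral with a real
  bound.\<close>

lemma Lp_norm_le_iff:
  assumes "0 < p" "0 \<le> c"
  shows "Lp_norm p f \<le> ennreal c \<longleftrightarrow>
    (\<integral>\<^sup>+ x. ennreal (\<bar>f x\<bar> powr p) \<partial>circle_measure) \<le> ennreal (c powr p)"
proof (cases "(\<integral>\<^sup>+ x. ennreal (\<bar>f x\<bar> powr p) \<partial>circle_measure)")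
  case (real I)
  have "I powr (1 / p) \<le> c \<longleftrightarrow> I \<le> c powr p"
  proof
    assume "I powr (1 / p) \<le> c"
    then have "(I powr (1 / p)) powr p \<le> c powr p" using assms by (intro powr_mono2) auto
    then show "I \<le> c powr p" using assms real by (simp add: powr_powr)
  next
    assume "I \<le> c powr p"
    then have "I powr (1 / p) \<le> (c powr p) powr (1 / p)" using assms real by (intro powr_mono2) auto
    then show "I powr (1 / p) \<le> c" using assms by (simp add: powr_powr)
  qed
  then show ?thesis using real assms by (simp add: Lp_norm_def)
next
  case top
  then show ?thesis by (simp add: Lp_norm_def top_unique)
qed

lemma Lp_norm_cong_AE:
  assumes "AE x in circle_measure. f x = g x"
  shows "Lp_norm p f = Lp_norm p g"
proof -
  have "(\<integral>\<^sup>+ x. ennreal (\<bar>f x\<bar> powr p) \<partial>circle_measure) =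
      (\<integral>\<^sup>+ x. ennreal (\<bar>g x\<bar> powr p) \<partial>circle_measure)"
    using assms by (intro nn_integral_cong_AE) auto
  then show ?thesis by (simp add: Lp_norm_def)
qed

text \<open>Jensen's inequality with exponent \<open>p / q\<close>, applied to
  \<open>\<bar>f x\<bar> powr q\<close> on a probability space.\<close>

lemma Lp_norm_mono_exponent:
  assumes [measurable]: "f \<in> borel_measurable circle_measure" and "1 \<le> q" "q \<le> p"
  shows "Lp_norm q f \<le> Lp_norm p f"
proof (cases "Lp_norm p f")
  case top
  then show ?thesis by simp
next
  case (real c)
  have p: "1 \<le> p" using assms(2,3) by linarith
  have q: "0 < q" using assms(2) by linarith
  have le: "(\<integral>\<^sup>+ x. ennreal (\<bar>f x\<bar> powr p) \<partial>circle_measure) \<le> ennreal (c powr p)"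
    by (rule Lp_norm_le_iff[THEN iffD1]) (use real p in simp_all)
  then have fin: "(\<integral>\<^sup>+ x. ennreal (\<bar>f x\<bar> powr p) \<partial>circle_measure) < \<infinity>"
    by (simp add: order_le_less_trans)
  define g where "g x = \<bar>f x\<bar> powr q" for x
  have [measurable]: "g \<in> borel_measurable circle_measure"
    unfolding g_def by measurable
  have g: "\<bar>g x\<bar> powr (p / q) = \<bar>f x\<bar> powr p" for x
    using q unfolding g_def by (simp add: powr_powr)
  have pq: "1 \<le> p / q" using q assms(3) by (simp add: le_divide_eq)
  have int: "integrable circle_measure g"
    by (rule circle.integrable_of_powr[OF _ pq]) (use fin g in auto)
  have g_nonneg: "0 \<le> g x" for x by (simp add: g_def)
  have "ennreal (\<bar>\<integral>t. g t \<partial>circle_measure\<bar> powr (p / q)) \<le> ennreal (c powr p)"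
    by (rule order_trans[OF circle.jensen_powr[OF _ pq]]) (use le in \<open>simp_all add: g\<close>)
  then have "\<bar>\<integral>t. g t \<partial>circle_measure\<bar> powr (p / q) \<le> c powr p"
    by (auto simp: ennreal_le_iff2)
  then have "(\<bar>\<integral>t. g t \<partial>circle_measure\<bar> powr (p / q)) powr (q / p) \<le> (c powr p) powr (q / p)"
    using q p by (intro powr_mono2) auto
  then have "\<bar>\<integral>t. g t \<partial>circle_measure\<bar> \<le> c powr q"
    using q p real by (simp add: powr_powr)
  then have "(\<integral>\<^sup>+ x. ennreal (g x) \<partial>circle_measure) \<le> ennreal (c powr q)"
    by (subst nn_integral_eq_integral[OF int]) (use g_nonneg in \<open>auto intro!: ennreal_leI\<close>)
  then have "Lp_norm q f \<le> ennreal c"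
    using real q by (subst Lp_norm_le_iff) (auto simp: g_def)
  then show ?thesis using real by simp
qed

text \<open>Normalising by the sum \<open>a + b\<close> of the norms, \<open>(f + g) / (a + b)\<close> is the convex combination of
  \<open>f / a\<close> and \<open>g / b\<close> with weights \<open>a / (a + b)\<close> and \<open>b / (a + b)\<close>.\<close>

lemma Lp_norm_triangle:
  assumes [measurable]: "f \<in> borel_measurable circle_measure" "g \<in> borel_measurable circle_measure"
    and p: "1 \<le> p"
  shows "Lp_norm p (\<lambda>x. f x + g x) \<le> Lp_norm p f + Lp_norm p g"
proof (cases "Lp_norm p f + Lp_norm p g = top")
  case True
  then show ?thesis by (metis top_greatest)
next
  case False
  then have ne: "Lp_norm p f \<noteq> top" "Lp_norm p g \<noteq> top" by auto
  obtain a0 where a0: "0 \<le> a0" "Lp_norm p f = ennreal a0"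
    using ne(1) by (cases "Lp_norm p f") auto
  obtain b0 where b0: "0 \<le> b0" "Lp_norm p g = ennreal b0"
    using ne(2) by (cases "Lp_norm p g") auto
  show ?thesis
  proof (rule ennreal_le_epsilon)
    fix e :: real
    assume e: "0 < e"
    \<comment> \<open>The added \<open>e / 2\<close> keeps both normalising constants positive even
      if a norm vanishes; the total excess is \<open>e\<close>.\<close>
    define a where "a = a0 + e / 2"
    define b where "b = b0 + e / 2"
    have ab: "0 < a" "0 < b" using a0 b0 e by (auto simp: a_def b_def)
    have F: "(\<integral>\<^sup>+ x. ennreal (\<bar>f x\<bar> powr p) \<partial>circle_measure) \<le> ennreal (a powr p)"
      using p ab a0 e by (subst Lp_norm_le_iff[symmetric]) (auto simp: a_def intro: ennreal_leI)
    have G: "(\<integral>\<^sup>+ x. ennreal (\<bar>g x\<bar> powr p) \<partial>circle_measure) \<le> ennreal (b powr p)"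
      using p ab b0 e by (subst Lp_norm_le_iff[symmetric]) (auto simp: b_def intro: ennreal_leI)
    \<comment> \<open>These are the coefficients left after multiplying the convexity inequality by
      \<open>(a + b) powr p\<close>. They are balanced so that
      \<open>\<alpha> * a powr p + \<beta> * b powr p = (a + b) powr p\<close>.\<close>
    define \<alpha> where "\<alpha> = (a + b) powr p * (a / (a + b)) / a powr p"
    define \<beta> where "\<beta> = (a + b) powr p * (b / (a + b)) / b powr p"
    have nn: "0 \<le> \<alpha>" "0 \<le> \<beta>" using ab by (auto simp: \<alpha>_def \<beta>_def)
    have pt: "\<bar>f x + g x\<bar> powr p \<le> \<alpha> * \<bar>f x\<bar> powr p + \<beta> * \<bar>g x\<bar> powr p" for x
    proof -
      let ?t = "b / (a + b)"
      have t1: "1 - ?t = a / (a + b)" using ab by (simp add: field_simps)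
      have "\<bar>(1 - ?t) * (f x / a) + ?t * (g x / b)\<bar> powr p
          \<le> (1 - ?t) * \<bar>f x / a\<bar> powr p + ?t * \<bar>g x / b\<bar> powr p"
        using convex_onD[OF convex_on_abs_powr[OF p], of ?t "f x / a" "g x / b"] ab
        by simp
      moreover have "(1 - ?t) * (f x / a) + ?t * (g x / b) = (f x + g x) / (a + b)"
        unfolding t1 using ab by (simp add: add_divide_distrib)
      ultimately have "\<bar>(f x + g x) / (a + b)\<bar> powr p
          \<le> a / (a + b) * \<bar>f x / a\<bar> powr p + ?t * \<bar>g x / b\<bar> powr p"
        unfolding t1 by simp
      then have "\<bar>f x + g x\<bar> powr p / (a + b) powr p
          \<le> a / (a + b) * (\<bar>f x\<bar> powr p / a powr p) + ?t * (\<bar>g x\<bar> powr p / b powr p)"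
        using ab by (simp add: abs_divide powr_divide)
      then have "\<bar>f x + g x\<bar> powr p \<le> (a + b) powr p *
          (a / (a + b) * (\<bar>f x\<bar> powr p / a powr p) + ?t * (\<bar>g x\<bar> powr p / b powr p))"
        using ab by (simp add: divide_le_eq mult.commute)
      then show ?thesis by (simp add: \<alpha>_def \<beta>_def algebra_simps)
    qed
    have "(\<integral>\<^sup>+ x. ennreal (\<bar>f x + g x\<bar> powr p) \<partial>circle_measure)
        \<le> (\<integral>\<^sup>+ x. (ennreal \<alpha> * ennreal (\<bar>f x\<bar> powr p) + ennreal \<beta> * ennreal (\<bar>g x\<bar> powr p)) \<partial>circle_measure)"
      using pt nn by (intro nn_integral_mono) (auto simp: ennreal_mult'[symmetric] ennreal_plus[symmetric] simp del: ennreal_plus intro!: ennreal_leI)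
    also have "\<dots> = ennreal \<alpha> * (\<integral>\<^sup>+ x. ennreal (\<bar>f x\<bar> powr p) \<partial>circle_measure)
        + ennreal \<beta> * (\<integral>\<^sup>+ x. ennreal (\<bar>g x\<bar> powr p) \<partial>circle_measure)"
      by (simp add: nn_integral_add nn_integral_cmult)
    also have "\<dots> \<le> ennreal \<alpha> * ennreal (a powr p) + ennreal \<beta> * ennreal (b powr p)"
      by (intro add_mono mult_left_mono F G) auto
    also have "\<dots> = ennreal (\<alpha> * a powr p + \<beta> * b powr p)"
      using nn by (simp add: ennreal_mult')
    also have "\<alpha> * a powr p + \<beta> * b powr p = (a + b) powr p * (a / (a + b) + b / (a + b))"
      using ab by (simp add: \<alpha>_def \<beta>_def distrib_left)
    also have "\<dots> = (a + b) powr p"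
      using ab by (simp add: add_divide_distrib[symmetric])
    finally have "Lp_norm p (\<lambda>x. f x + g x) \<le> ennreal (a + b)"
      using p ab by (subst Lp_norm_le_iff) auto
    also have "\<dots> = Lp_norm p f + Lp_norm p g + ennreal e"
      using a0 b0 e by (simp add: a_def b_def ennreal_plus[symmetric] del: ennreal_plus)
    finally show "Lp_norm p (\<lambda>x. f x + g x) \<le> Lp_norm p f + Lp_norm p g + ennreal e" .
  qed
qed

lemma Lp_norm_minus: "Lp_norm p (\<lambda>x. - f x) = Lp_norm p f"
  by (simp add: Lp_norm_def)

lemma Lp_norm_sum_le:
  fixes n :: nat
  assumes "\<And>i. i < n \<Longrightarrow> f i \<in> borel_measurable circle_measure" and "1 \<le> p"
  shows "Lp_norm p (\<lambda>x. \<Sum>i<n. f i x) \<le> (\<Sum>i<n. Lp_norm p (f i))"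
  using assms(1)
proof (induction n)
  case 0
  have "Lp_norm p (\<lambda>x. 0) \<le> ennreal 0"
    using assms(2) by (subst Lp_norm_le_iff) auto
  then show ?case by simp
next
  case (Suc n)
  have [measurable]: "f n \<in> borel_measurable circle_measure"
    "(\<lambda>x. \<Sum>i<n. f i x) \<in> borel_measurable circle_measure"
    using Suc.prems by (auto intro: borel_measurable_sum)
  have "Lp_norm p (\<lambda>x. (\<Sum>i<n. f i x) + f n x) \<le> Lp_norm p (\<lambda>x. \<Sum>i<n. f i x) + Lp_norm p (f n)"
    using assms(2) by (intro Lp_norm_triangle) auto
  also have "\<dots> \<le> (\<Sum>i<n. Lp_norm p (f i)) + Lp_norm p (f n)"
    using Suc by (intro add_right_mono) auto
  finally show ?case by simp
qed

section \<open>Periodic functions and their averages\<close>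

definition periodic :: "(real \<Rightarrow> 'a) \<Rightarrow> bool" where
  "periodic F \<longleftrightarrow> (\<forall>x. F (x + 2 * pi) = F x)"

lemma periodic_int:
  assumes "periodic F"
  shows "F (x + 2 * pi * of_int k) = F x"
proof -
  have nat: "F (y + 2 * pi * of_nat n) = F y" for y n
  proof (induction n)
    case (Suc n)
    have "F (y + 2 * pi * of_nat (Suc n)) = F ((y + 2 * pi * of_nat n) + 2 * pi)"
      by (simp add: algebra_simps)
    then show ?case using assms Suc by (simp add: periodic_def)
  qed simp
  show ?thesis
  proof (cases "0 \<le> k")
    case True
    then show ?thesis using nat[of x "nat k"] by simp
  next
    case False
    then show ?thesis using nat[of "x + 2 * pi * of_int k" "nat (- k)"] by (simp add: algebra_simps)
  qed
qed

section \<open>Translation invariance over one period\<close>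

lemma nn_integral_lborel_shift:
  fixes G :: "real \<Rightarrow> ennreal"
  assumes "G \<in> borel_measurable borel"
  shows "(\<integral>\<^sup>+ x. G (x + h) \<partial>lborel) = (\<integral>\<^sup>+ x. G x \<partial>lborel)"
  using nn_integral_real_affine[OF assms, of 1 h] by (simp add: add.commute)

text \<open>By periodicity \<open>h\<close> may be replaced by its remainder \<open>d\<close> modulo
  the period. The translated interval is then cut at \<open>2*pi\<close>, and the piece beyond is
  moved back by one period to fill the gap below \<open>d\<close>.\<close>

lemma nn_integral_period_shift:
  fixes G :: "real \<Rightarrow> ennreal"
  assumes [measurable]: "G \<in> borel_measurable borel" and per: "periodic G"
  shows "(\<integral>\<^sup>+ x. G (x + h) * indicator {0..2*pi} x \<partial>lborel) =
    (\<integral>\<^sup>+ x. G x * indicator {0..2*pi} x \<partial>lborel)"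
proof -
  define d where "d = h rmod (2 * pi)"
  have d: "0 \<le> d" "d < 2 * pi"
    by (auto simp: d_def rmod_nonneg rmod_less)
  have "h = d + 2 * pi * of_int \<lfloor>h / (2 * pi)\<rfloor>"
    by (simp add: d_def rmod_def)
  then have Gh: "G (x + h) = G (x + d)" for x
    using periodic_int[OF per, of "x + d" "\<lfloor>h / (2 * pi)\<rfloor>"] by (simp add: add.assoc)
  \<comment> \<open>Half-open intervals let the pieces fit together without overlap; only a null
    point is dropped.\<close>
  have half_open: "(\<integral>\<^sup>+ x. H x * indicator {0..2*pi} x \<partial>lborel) =
      (\<integral>\<^sup>+ x. H x * indicator {0..<2*pi} x \<partial>lborel)" for H :: "real \<Rightarrow> ennreal"
    by (rule nn_integral_cong_AE, rule eventually_mono[OF AE_lborel_singleton[of "2*pi"]])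
       (auto simp: indicator_def)
  have "(\<integral>\<^sup>+ x. G (x + h) * indicator {0..2*pi} x \<partial>lborel) =
      (\<integral>\<^sup>+ x. G (x + d) * indicator {d..<2*pi + d} (x + d) \<partial>lborel)"
    unfolding half_open Gh by (intro nn_integral_cong) (auto simp: indicator_def)
  also have "\<dots> = (\<integral>\<^sup>+ x. G x * indicator {d..<2*pi + d} x \<partial>lborel)"
    by (rule nn_integral_lborel_shift) measurable
  also have "\<dots> = (\<integral>\<^sup>+ x. G x * indicator {d..<2*pi} x + G x * indicator {2*pi..<2*pi + d} x \<partial>lborel)"
    using d by (intro nn_integral_cong) (auto simp: indicator_def)
  also have "\<dots> = (\<integral>\<^sup>+ x. G x * indicator {d..<2*pi} x \<partial>lborel) +
      (\<integral>\<^sup>+ x. G x * indicator {2*pi..<2*pi + d} x \<partial>lborel)"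
    by (simp add: nn_integral_add)
  also have "(\<integral>\<^sup>+ x. G x * indicator {2*pi..<2*pi + d} x \<partial>lborel) =
      (\<integral>\<^sup>+ x. G (x + 2*pi) * indicator {2*pi..<2*pi + d} (x + 2*pi) \<partial>lborel)"
    by (rule nn_integral_lborel_shift[symmetric]) measurable
  also have "\<dots> = (\<integral>\<^sup>+ x. G x * indicator {0..<d} x \<partial>lborel)"
    using per by (intro nn_integral_cong) (auto simp: indicator_def periodic_def)
  also have "(\<integral>\<^sup>+ x. G x * indicator {d..<2*pi} x \<partial>lborel) + \<dots> =
      (\<integral>\<^sup>+ x. G x * indicator {d..<2*pi} x + G x * indicator {0..<d} x \<partial>lborel)"
    by (simp add: nn_integral_add)
  also have "\<dots> = (\<integral>\<^sup>+ x. G x * indicator {0..<2*pi} x \<partial>lborel)"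
    using d by (intro nn_integral_cong) (auto simp: indicator_def)
  finally show ?thesis by (simp add: half_open)
qed

lemma nn_integral_circle_shift:
  fixes G :: "real \<Rightarrow> ennreal"
  assumes [measurable]: "G \<in> borel_measurable borel" and "periodic G"
  shows "(\<integral>\<^sup>+ x. G (x + h) \<partial>circle_measure) = (\<integral>\<^sup>+ x. G x \<partial>circle_measure)"
  using nn_integral_period_shift[OF assms, of h] by (simp add: nn_integral_circle)

lemma periodic_compose: "periodic F \<Longrightarrow> periodic (\<lambda>x. g (F x))"
  by (simp add: periodic_def)

lemma Lp_norm_shift:
  fixes F :: "real \<Rightarrow> real"
  assumes [measurable]: "F \<in> borel_measurable borel" and "periodic F"
  shows "Lp_norm p (\<lambda>x. F (x + h)) = Lp_norm p F"
proof -
  have "(\<integral>\<^sup>+ x. ennreal (\<bar>F (x + h)\<bar> powr p) \<partial>circle_measure) =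
      (\<integral>\<^sup>+ x. ennreal (\<bar>F x\<bar> powr p) \<partial>circle_measure)"
    by (rule nn_integral_circle_shift[where G = "\<lambda>x. ennreal (\<bar>F x\<bar> powr p)"])
       (measurable, rule periodic_compose[OF assms(2)])
  then show ?thesis by (simp add: Lp_norm_def)
qed

section \<open>Averages over a symmetric window\<close>

definition window :: "real \<Rightarrow> real measure" where
  "window r = uniform_measure lborel {-r..r}"

definition avg :: "real \<Rightarrow> (real \<Rightarrow> real) \<Rightarrow> real \<Rightarrow> real" where
  "avg r F x = (\<integral>t. F (x + t) \<partial>window r)"

lemma sets_window [simp, measurable_cong]: "sets (window r) = sets borel"
  by (simp add: window_def)

lemma space_window [simp]: "space (window r) = UNIV"
  by (simp add: window_def)

lemma prob_space_window: "0 < r \<Longrightarrow> prob_space (window r)"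
  unfolding window_def by (intro prob_space_uniform_measure) auto

lemma AE_window: "AE t in window r. \<bar>t\<bar> \<le> r"
  unfolding window_def by (rule AE_uniform_measureI) (auto intro!: AE_I2)

text \<open>The window has length at most one period, so its integral is dominated by that over a
  full period. The constant is the ratio of the densities \<open>1 / (2*r)\<close> and
  \<open>1 / (2*pi)\<close>.\<close>

lemma nn_integral_window_le:
  fixes G :: "real \<Rightarrow> ennreal"
  assumes [measurable]: "G \<in> borel_measurable borel" and per: "periodic G"
    and r: "0 < r" "r \<le> pi"
  shows "(\<integral>\<^sup>+ t. G (x + t) \<partial>window r) \<le> ennreal (pi / r) * (\<integral>\<^sup>+ y. G y \<partial>circle_measure)"
proof -
  have "(\<integral>\<^sup>+ t. G (x + t) * indicator {-r..r} t \<partial>lborel)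
      \<le> (\<integral>\<^sup>+ t. G (t + x) * indicator {-pi..pi} t \<partial>lborel)"
    using r by (intro nn_integral_mono) (auto simp: indicator_def add.commute)
  also have "\<dots> = (\<integral>\<^sup>+ t. G (t + (- pi) + x) * indicator {-pi..pi} (t + (- pi)) \<partial>lborel)"
    by (rule nn_integral_lborel_shift[symmetric]) measurable
  also have "\<dots> = (\<integral>\<^sup>+ t. G (t + (x - pi)) * indicator {0..2*pi} t \<partial>lborel)"
    by (intro nn_integral_cong) (auto simp: indicator_def algebra_simps)
  also have "\<dots> = (\<integral>\<^sup>+ t. G t * indicator {0..2*pi} t \<partial>lborel)"
    by (rule nn_integral_period_shift[OF _ per]) measurable
  also have "\<dots> = ennreal (2*pi) * (ennreal (1 / (2*pi)) * (\<integral>\<^sup>+ t. G t * indicator {0..2*pi} t \<partial>lborel))"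
    by (simp add: mult.assoc[symmetric] ennreal_mult'[symmetric])
  also have "\<dots> = ennreal (2*pi) * (\<integral>\<^sup>+ y. G y \<partial>circle_measure)"
    by (simp add: nn_integral_circle)
  finally have le: "(\<integral>\<^sup>+ t. G (x + t) * indicator {-r..r} t \<partial>lborel)
      \<le> ennreal (2*pi) * (\<integral>\<^sup>+ y. G y \<partial>circle_measure)" .
  have "(\<integral>\<^sup>+ t. G (x + t) \<partial>window r) =
      (\<integral>\<^sup>+ t. G (x + t) * indicator {-r..r} t \<partial>lborel) / ennreal (2 * r)"
    using r unfolding window_def by (subst nn_integral_uniform_measure) auto
  also have "\<dots> \<le> (ennreal (2*pi) * (\<integral>\<^sup>+ y. G y \<partial>circle_measure)) / ennreal (2 * r)"
    by (rule divide_right_mono_ennreal[OF le])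
  also have "\<dots> = (\<integral>\<^sup>+ y. G y \<partial>circle_measure) * (ennreal (2*pi) / ennreal (2 * r))"
    by (simp add: ennreal_times_divide mult.commute)
  also have "ennreal (2*pi) / ennreal (2 * r) = ennreal (pi / r)"
    using r by (simp add: divide_ennreal)
  finally show ?thesis by (simp add: mult.commute)
qed

text \<open>Minkowski's integral inequality for a probability measure: Jensen in the inner integral,
  then exchange of the integrals. It gives both the contractivity of averages and their distance
  from the function.\<close>

lemma Lp_norm_integral_le:
  fixes H :: "real \<Rightarrow> real \<Rightarrow> real"
  assumes "prob_space M" "sets M = sets borel"
    and H: "case_prod H \<in> borel_measurable (borel \<Otimes>\<^sub>M borel)"
    and p: "1 \<le> p" and c: "0 \<le> c" and le: "AE t in M. Lp_norm p (\<lambda>x. H x t) \<le> ennreal c"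
  shows "Lp_norm p (\<lambda>x. \<integral>t. H x t \<partial>M) \<le> ennreal c"
proof -
  interpret M: prob_space M by fact
  interpret pair_sigma_finite circle_measure M ..
  have [measurable]: "case_prod H \<in> borel_measurable (circle_measure \<Otimes>\<^sub>M M)"
    by (rule measurable_circle_pair[OF assms(2) H])
  have "(\<integral>\<^sup>+ x. ennreal (\<bar>\<integral>t. H x t \<partial>M\<bar> powr p) \<partial>circle_measure)
      \<le> (\<integral>\<^sup>+ x. (\<integral>\<^sup>+ t. ennreal (\<bar>H x t\<bar> powr p) \<partial>M) \<partial>circle_measure)"
    using p by (intro nn_integral_mono M.jensen_powr) auto
  also have "\<dots> = (\<integral>\<^sup>+ t. (\<integral>\<^sup>+ x. ennreal (\<bar>H x t\<bar> powr p) \<partial>circle_measure) \<partial>M)"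
    by (rule Fubini'[symmetric]) measurable
  also have "\<dots> \<le> (\<integral>\<^sup>+ t. ennreal (c powr p) \<partial>M)"
    using le p c by (intro nn_integral_mono_AE) (auto simp: Lp_norm_le_iff)
  also have "\<dots> = ennreal (c powr p)" by (simp add: M.emeasure_space_1)
  finally show ?thesis using p c by (subst Lp_norm_le_iff) auto
qed

section \<open>Smoothing by averages\<close>

lemma measurable_avg [measurable]:
  assumes [measurable]: "F \<in> borel_measurable borel" and r: "0 < r"
  shows "avg r F \<in> borel_measurable borel"
proof -
  interpret prob_space "window r" by (rule prob_space_window[OF r])
  have "(\<lambda>x. \<integral>t. F (x + t) \<partial>window r) \<in> borel_measurable borel"
    by (rule borel_measurable_lebesgue_integral) measurable
  then show ?thesis by (simp add: avg_def[abs_def])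
qed

lemma periodic_avg: "periodic F \<Longrightarrow> periodic (avg r F)"
  by (simp add: periodic_def avg_def add.commute[of _ "2 * pi"] add.left_commute add.assoc)
     (simp add: add.assoc[symmetric] add.commute[of "2 * pi"])

lemma Lp_norm_avg_le:
  assumes [measurable]: "F \<in> borel_measurable borel" and per: "periodic F" and r: "0 < r" and p: "1 \<le> p"
  shows "Lp_norm p (avg r F) \<le> Lp_norm p F"
proof (cases "Lp_norm p F")
  case (real c)
  have "Lp_norm p (\<lambda>x. \<integral>t. F (x + t) \<partial>window r) \<le> ennreal c"
    by (rule Lp_norm_integral_le[OF prob_space_window[OF r] sets_window])
       (use p real Lp_norm_shift[OF assms(1) per] in auto)
  then show ?thesis by (simp add: avg_def[abs_def] real)
qed simp

lemma Lp_norm_avg_diff_le: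
  assumes [measurable]: "F \<in> borel_measurable borel" and r: "0 < r" and p: "1 \<le> p" and w: "0 \<le> w"
    and int: "\<And>x. integrable (window r) (\<lambda>t. F (x + t))"
    and le: "\<And>h. \<bar>h\<bar> \<le> r \<Longrightarrow> Lp_norm p (\<lambda>x. F (x + h) - F x) \<le> ennreal w"
  shows "Lp_norm p (\<lambda>x. avg r F x - F x) \<le> ennreal w"
proof -
  interpret prob_space "window r" by (rule prob_space_window[OF r])
  have "Lp_norm p (\<lambda>x. \<integral>t. F (x + t) - F x \<partial>window r) \<le> ennreal w"
    by (rule Lp_norm_integral_le[OF prob_space_window[OF r] sets_window])
       (use p w le in \<open>auto intro: eventually_mono[OF AE_window]\<close>)
  \<comment> \<open>The integral may be split because of \<open>int\<close>; without integrability
    the Bochner integral would take its default value 0.\<close>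
  moreover have "(\<integral>t. F (x + t) - F x \<partial>window r) = avg r F x - F x" for x
    using int[of x] by (simp add: avg_def prob_space[unfolded space_window])
  ultimately show ?thesis by simp
qed

lemma nn_integral_powr_window_le:
  assumes [measurable]: "F \<in> borel_measurable borel" and per: "periodic F"
    and r: "0 < r" "r \<le> pi" and p: "1 \<le> p" and c: "0 \<le> c" "Lp_norm p F \<le> ennreal c"
  shows "(\<integral>\<^sup>+ t. ennreal (\<bar>F (x + t)\<bar> powr p) \<partial>window r) \<le> ennreal (pi / r * c powr p)"
proof -
  have "(\<integral>\<^sup>+ t. ennreal (\<bar>F (x + t)\<bar> powr p) \<partial>window r)
      \<le> ennreal (pi / r) * (\<integral>\<^sup>+ y. ennreal (\<bar>F y\<bar> powr p) \<partial>circle_measure)"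
    by (rule nn_integral_window_le[where G = "\<lambda>y. ennreal (\<bar>F y\<bar> powr p)"])
       (use r periodic_compose[OF per] in auto)
  also have "\<dots> \<le> ennreal (pi / r) * ennreal (c powr p)"
    using p c by (intro mult_left_mono) (auto simp: Lp_norm_le_iff)
  also have "\<dots> = ennreal (pi / r * c powr p)"
    using r by (simp add: ennreal_mult'[symmetric])
  finally show ?thesis .
qed

text \<open>As a window fits into one period, integrability holds at every \<open>x\<close>, not
  just at almost every one. Hence \<open>avg\<close> does not fall back on the default value of the
  integral at any point.\<close>

lemma integrable_window:
  assumes [measurable]: "F \<in> borel_measurable borel" and per: "periodic F"
    and r: "0 < r" "r \<le> pi" and p: "1 \<le> p" and fin: "Lp_norm p F < top"
  shows "integrable (window r) (\<lambda>t. F (x + t))"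
proof -
  interpret prob_space "window r" by (rule prob_space_window[OF r(1)])
  obtain c where c: "0 \<le> c" "Lp_norm p F = ennreal c"
    using fin by (cases "Lp_norm p F") auto
  have "(\<integral>\<^sup>+ t. ennreal (\<bar>F (x + t)\<bar> powr p) \<partial>window r) \<le> ennreal (pi / r * c powr p)"
    by (rule nn_integral_powr_window_le[OF assms(1-5)]) (use c in auto)
  also have "\<dots> < \<infinity>" by simp
  finally show ?thesis by (intro integrable_of_powr[OF _ p]) auto
qed

text \<open>Jensen's inequality moves the power inside the average, the window estimate costs the
  factor \<open>pi / r\<close>, and a \<open>p\<close>-th root follows.\<close>

lemma avg_bound:
  assumes [measurable]: "F \<in> borel_measurable borel" and per: "periodic F"
    and r: "0 < r" "r \<le> pi" and p: "1 \<le> p" and c: "0 \<le> c" "Lp_norm p F \<le> ennreal c"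
  shows "\<bar>avg r F x\<bar> \<le> (pi / r) powr (1 / p) * c"
proof -
  interpret prob_space "window r" by (rule prob_space_window[OF r(1)])
  have "ennreal (\<bar>avg r F x\<bar> powr p) \<le> (\<integral>\<^sup>+ t. ennreal (\<bar>F (x + t)\<bar> powr p) \<partial>window r)"
    unfolding avg_def by (rule jensen_powr[OF _ p]) measurable
  also have "\<dots> \<le> ennreal (pi / r * c powr p)"
    by (rule nn_integral_powr_window_le[OF assms])
  finally have "\<bar>avg r F x\<bar> powr p \<le> pi / r * c powr p"
    using r by (subst (asm) ennreal_le_iff) auto
  then have "(\<bar>avg r F x\<bar> powr p) powr (1 / p) \<le> (pi / r * c powr p) powr (1 / p)"
    using p by (intro powr_mono2) auto
  moreover have "(pi / r * c powr p) powr (1 / p) = (pi / r) powr (1 / p) * c"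
    using p c(1) r by (subst powr_mult) (auto simp: powr_powr)
  ultimately show ?thesis using p by (simp add: powr_powr)
qed

text \<open>Interpolation between the uniform bound for the average and its contractivity in \<open>L\<^sub>p\<close>.\<close>

lemma Lp_norm_avg_smoothing:
  assumes [measurable]: "F \<in> borel_measurable borel" and per: "periodic F"
    and r: "0 < r" "r \<le> pi" and p: "1 \<le> p" "p < q" and c: "0 \<le> c" "Lp_norm p F \<le> ennreal c"
  shows "Lp_norm q (avg r F) \<le> ennreal ((pi / r) powr (1 / p - 1 / q) * c)"
proof -
  define K where "K = (pi / r) powr (1 / p) * c"
  have K: "0 \<le> K" using c by (simp add: K_def)
  \<comment> \<open>The power \<open>q\<close> is split as \<open>(q - p) + p\<close>: the first
    factor is bounded uniformly, the second is integrated.\<close>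
  have pt: "\<bar>avg r F x\<bar> powr q \<le> K powr (q - p) * \<bar>avg r F x\<bar> powr p" for x
  proof -
    have "\<bar>avg r F x\<bar> powr q = \<bar>avg r F x\<bar> powr (q - p) * \<bar>avg r F x\<bar> powr p"
      by (simp add: powr_add[symmetric])
    also have "\<dots> \<le> K powr (q - p) * \<bar>avg r F x\<bar> powr p"
      using avg_bound[OF assms(1-5) c, of x] p
      by (intro mult_right_mono powr_mono2) (auto simp: K_def)
    finally show ?thesis .
  qed
  have "Lp_norm p (avg r F) \<le> ennreal c"
    using Lp_norm_avg_le[OF assms(1) per r(1) p(1)] c(2) by (rule order_trans)
  then have le: "(\<integral>\<^sup>+ x. ennreal (\<bar>avg r F x\<bar> powr p) \<partial>circle_measure) \<le> ennreal (c powr p)"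
    using p c by (subst (asm) Lp_norm_le_iff) auto
  have [measurable]: "avg r F \<in> borel_measurable circle_measure"
    by (rule borel_measurable_circle, rule measurable_avg) (use r in auto)
  have "(\<integral>\<^sup>+ x. ennreal (\<bar>avg r F x\<bar> powr q) \<partial>circle_measure)
      \<le> (\<integral>\<^sup>+ x. ennreal (K powr (q - p)) * ennreal (\<bar>avg r F x\<bar> powr p) \<partial>circle_measure)"
    using pt by (intro nn_integral_mono) (auto simp: ennreal_mult'[symmetric] intro!: ennreal_leI)
  also have "\<dots> = ennreal (K powr (q - p)) * (\<integral>\<^sup>+ x. ennreal (\<bar>avg r F x\<bar> powr p) \<partial>circle_measure)"
    by (rule nn_integral_cmult) measurable
  also have "\<dots> \<le> ennreal (K powr (q - p)) * ennreal (c powr p)"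
    by (rule mult_left_mono[OF le]) simp
  also have "\<dots> = ennreal (K powr (q - p) * c powr p)"
    by (simp add: ennreal_mult')
  also have "K powr (q - p) * c powr p = (pi / r) powr (1 / p * (q - p)) * (c powr (q - p) * c powr p)"
    using r c by (simp add: K_def powr_mult powr_powr)
  also have "c powr (q - p) * c powr p = c powr q"
    by (simp add: powr_add[symmetric])
  \<comment> \<open>Writing the exponent as a multiple of \<open>q\<close> allows the
    \<open>q\<close>-th root to be read off.\<close>
  also have "1 / p * (q - p) = (1 / p - 1 / q) * q"
    using p by (simp add: field_simps)
  also have "(pi / r) powr ((1 / p - 1 / q) * q) * c powr q = ((pi / r) powr (1 / p - 1 / q) * c) powr q"
    using r c by (simp add: powr_mult powr_powr)
  finally show ?thesis
    using p r c by (subst Lp_norm_le_iff) auto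
qed

text \<open>Fubini's theorem on the product of the two windows. Its integrability condition follows
  from the finite \<open>L_1\<close> norm, which the \<open>L_p\<close> norm dominates, through
  \<open>nn_integral_window_le\<close>.\<close>

lemma avg_commute:
  assumes [measurable]: "F \<in> borel_measurable borel" and per: "periodic F"
    and r: "0 < r" "r \<le> pi" and s: "0 < s" "s \<le> pi" and p: "1 \<le> p" and fin: "Lp_norm p F < top"
  shows "avg r (avg s F) x = avg s (avg r F) x"
proof -
  interpret R: prob_space "window r" by (rule prob_space_window[OF r(1)])
  interpret S: prob_space "window s" by (rule prob_space_window[OF s(1)])
  interpret pair_sigma_finite "window r" "window s" ..
  have fin1: "(\<integral>\<^sup>+ y. ennreal \<bar>F y\<bar> \<partial>circle_measure) < top"
  proof -
    have "Lp_norm 1 F \<le> Lp_norm p F"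
      using p by (intro Lp_norm_mono_exponent borel_measurable_circle assms(1)) auto
    then have lt: "Lp_norm 1 F < top" using fin by (rule order_le_less_trans)
    then obtain a where a: "0 \<le> a" "Lp_norm 1 F = ennreal a" by (cases "Lp_norm 1 F") auto
    then have "(\<integral>\<^sup>+ y. ennreal (\<bar>F y\<bar> powr 1) \<partial>circle_measure) \<le> ennreal (a powr 1)"
      by (intro Lp_norm_le_iff[THEN iffD1]) auto
    also have "\<dots> < top" by simp
    finally show ?thesis by simp
  qed
  have "integrable (window r \<Otimes>\<^sub>M window s) (\<lambda>(t, u). F (x + t + u))"
  proof (rule integrableI_bounded)
    have "(\<integral>\<^sup>+ z. ennreal (norm (case z of (t, u) \<Rightarrow> F (x + t + u))) \<partial>(window r \<Otimes>\<^sub>M window s))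
        = (\<integral>\<^sup>+ t. (\<integral>\<^sup>+ u. ennreal \<bar>F (x + t + u)\<bar> \<partial>window s) \<partial>window r)"
      by (subst S.nn_integral_fst[symmetric]) auto
    also have "\<dots> \<le> (\<integral>\<^sup>+ t. ennreal (pi / s) * (\<integral>\<^sup>+ y. ennreal \<bar>F y\<bar> \<partial>circle_measure) \<partial>window r)"
      by (intro nn_integral_mono nn_integral_window_le[where G = "\<lambda>y. ennreal \<bar>F y\<bar>"])
         (use s periodic_compose[OF per] in auto)
    also have "\<dots> = ennreal (pi / s) * (\<integral>\<^sup>+ y. ennreal \<bar>F y\<bar> \<partial>circle_measure)"
      using R.emeasure_space_1 by simp
    also have "\<dots> < \<infinity>"
      using fin1 by (simp add: ennreal_mult_less_top)
    finally show "(\<integral>\<^sup>+ z. ennreal (norm (case z of (t, u) \<Rightarrow> F (x + t + u))) \<partial>(window r \<Otimes>\<^sub>M window s)) < \<infinity>" .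
  qed measurable
  then have "(\<integral>u. (\<integral>t. F (x + t + u) \<partial>window r) \<partial>window s) = (\<integral>t. (\<integral>u. F (x + t + u) \<partial>window s) \<partial>window r)"
    by (rule Fubini_integral)
  moreover have "avg s (avg r F) x = (\<integral>u. (\<integral>t. F (x + t + u) \<partial>window r) \<partial>window s)"
    unfolding avg_def by (intro Bochner_Integration.integral_cong refl arg_cong[of _ _ F]) simp_all
  ultimately show ?thesis by (simp add: avg_def)
qed

text \<open>Each of the two terms is an average of a function with \<open>L_p\<close> norm at most
  \<open>w\<close>, so smoothing applies to both. The smaller radius \<open>s\<close> gives the
  larger constant, and the two terms give the factor 2.\<close>

lemma Lp_norm_avg_step:
  assumes [measurable]: "F \<in> borel_measurable borel" and per: "periodic F"
    and s: "0 < s" "s \<le> r" "r \<le> pi" and p: "1 \<le> p" "p < q" and fin: "Lp_norm p F < top"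
    and w: "0 \<le> w" "\<And>h. \<bar>h\<bar> \<le> r \<Longrightarrow> Lp_norm p (\<lambda>x. F (x + h) - F x) \<le> ennreal w"
  shows "Lp_norm q (\<lambda>x. avg s F x - avg r F x) \<le> ennreal (2 * (pi / s) powr (1 / p - 1 / q) * w)"
proof -
  have r: "0 < r" "s \<le> pi" using s by auto
  have [measurable]: "avg r F \<in> borel_measurable borel" "avg s F \<in> borel_measurable borel"
    using r s by measurable
  have fin_avg: "Lp_norm p (avg a F) < top" if "0 < a" for a
    by (rule order_le_less_trans[OF Lp_norm_avg_le[OF assms(1) per that p(1)] fin])
  define D where "D = (\<lambda>x. avg r F x - F x)"
  define E where "E = (\<lambda>x. avg s F x - F x)"
  have [measurable]: "D \<in> borel_measurable borel" "E \<in> borel_measurable borel"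
    unfolding D_def E_def by measurable
  have perDE: "periodic D" "periodic E"
    using per periodic_avg[OF per, of r] periodic_avg[OF per, of s]
    by (auto simp: D_def E_def periodic_def)
  have D: "Lp_norm p D \<le> ennreal w"
    unfolding D_def
    by (rule Lp_norm_avg_diff_le) (use r p w integrable_window[OF assms(1) per r(1) s(3) p(1) fin] in auto)
  have E: "Lp_norm p E \<le> ennreal w"
    unfolding E_def
    by (rule Lp_norm_avg_diff_le) (use r s p w integrable_window[OF assms(1) per s(1) r(2) p(1) fin] in auto)
  have avgD: "avg s D x = avg s (avg r F) x - avg s F x" for x
    unfolding D_def avg_def[of s]
    by (intro Bochner_Integration.integral_diff integrable_window[OF _ _ s(1) r(2) p(1)])
       (use per periodic_avg[OF per] fin fin_avg r s in auto)
  have avgE: "avg r E x = avg r (avg s F) x - avg r F x" for x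
    unfolding E_def avg_def[of r]
    by (intro Bochner_Integration.integral_diff integrable_window[OF _ _ r(1) s(3) p(1)])
       (use per periodic_avg[OF per] fin fin_avg r s in auto)
  \<comment> \<open>Commutation makes the two double averages cancel.\<close>
  have eq: "avg s F x - avg r F x = - avg s D x + avg r E x" for x
    using avg_commute[OF assms(1) per r(1) s(3) s(1) r(2) p(1) fin, of x] by (simp add: avgD avgE)
  have mono: "(pi / r) powr (1 / p - 1 / q) \<le> (pi / s) powr (1 / p - 1 / q)"
    using r s p by (intro powr_mono2 divide_left_mono) (auto simp: frac_le)
  have [measurable]: "avg s D \<in> borel_measurable circle_measure" "avg r E \<in> borel_measurable circle_measure"
    by (rule borel_measurable_circle, rule measurable_avg; use r s in simp)+
  have "Lp_norm q (\<lambda>x. avg s F x - avg r F x) \<le> Lp_norm q (\<lambda>x. - avg s D x) + Lp_norm q (avg r E)"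
    unfolding eq using p by (intro Lp_norm_triangle) auto
  also have "\<dots> \<le> ennreal ((pi / s) powr (1 / p - 1 / q) * w) + ennreal ((pi / r) powr (1 / p - 1 / q) * w)"
    unfolding Lp_norm_minus
    by (intro add_mono Lp_norm_avg_smoothing) (use perDE r s p w D E in auto)
  also have "\<dots> \<le> ennreal ((pi / s) powr (1 / p - 1 / q) * w) + ennreal ((pi / s) powr (1 / p - 1 / q) * w)"
    using mono w(1) by (intro add_left_mono ennreal_leI mult_right_mono)
  also have "\<dots> = ennreal (2 * (pi / s) powr (1 / p - 1 / q) * w)"
    using w(1) by (simp add: ennreal_plus[symmetric] del: ennreal_plus)
  finally show ?thesis .
qed

section \<open>Summation of the averages\<close>

lemma Lp_norm_Fatou:
  assumes [measurable]: "\<And>n. u n \<in> borel_measurable circle_measure"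
    and q: "0 < q" and c: "0 \<le> c" and le: "\<And>n. Lp_norm q (u n) \<le> ennreal c"
    and lim: "AE x in circle_measure. (\<lambda>n. u n x) \<longlonglongrightarrow> f x"
  shows "Lp_norm q f \<le> ennreal c"
proof -
  have "AE x in circle_measure. ennreal (\<bar>f x\<bar> powr q) = liminf (\<lambda>n. ennreal (\<bar>u n x\<bar> powr q))"
    using lim
  proof eventually_elim
    case (elim x)
    have "(\<lambda>n. ennreal (\<bar>u n x\<bar> powr q)) \<longlonglongrightarrow> ennreal (\<bar>f x\<bar> powr q)"
      using q by (intro tendsto_ennrealI tendsto_powr' tendsto_rabs elim tendsto_const) auto
    then show ?case by (intro lim_imp_Liminf[symmetric]) auto
  qed
  then have "(\<integral>\<^sup>+ x. ennreal (\<bar>f x\<bar> powr q) \<partial>circle_measure) =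
      (\<integral>\<^sup>+ x. liminf (\<lambda>n. ennreal (\<bar>u n x\<bar> powr q)) \<partial>circle_measure)"
    by (rule nn_integral_cong_AE)
  also have "\<dots> \<le> liminf (\<lambda>n. \<integral>\<^sup>+ x. ennreal (\<bar>u n x\<bar> powr q) \<partial>circle_measure)"
    by (rule nn_integral_liminf) measurable
  also have "\<dots> \<le> ennreal (c powr q)"
    using le q c by (intro Liminf_le) (auto simp: Lp_norm_le_iff)
  finally show ?thesis using q c by (subst Lp_norm_le_iff) auto
qed

text \<open>Summing before integrating shows that the series of distances is finite almost
  everywhere, so its terms tend to 0. Thus the whole sequence converges, not only a
  subsequence.\<close>

lemma AE_tendsto_of_summable_L1:
  assumes [measurable]: "\<And>n. u n \<in> borel_measurable circle_measure" "f \<in> borel_measurable circle_measure"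
    and le: "\<And>n. Lp_norm 1 (\<lambda>x. u n x - f x) \<le> ennreal (w n)"
    and w: "\<And>n. 0 \<le> w n" "(\<Sum>n. ennreal (w n)) < top"
  shows "AE x in circle_measure. (\<lambda>n. u n x) \<longlonglongrightarrow> f x"
proof -
  have le': "(\<integral>\<^sup>+ x. ennreal \<bar>u n x - f x\<bar> \<partial>circle_measure) \<le> ennreal (w n)" for n
    using le[of n] w(1)[of n] by (subst (asm) Lp_norm_le_iff) auto
  have "(\<integral>\<^sup>+ x. (\<Sum>n. ennreal \<bar>u n x - f x\<bar>) \<partial>circle_measure) =
      (\<Sum>n. \<integral>\<^sup>+ x. ennreal \<bar>u n x - f x\<bar> \<partial>circle_measure)"
    by (rule nn_integral_suminf) measurable
  also have "\<dots> \<le> (\<Sum>n. ennreal (w n))"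
    by (intro suminf_le le' summableI)
  finally have "(\<integral>\<^sup>+ x. (\<Sum>n. ennreal \<bar>u n x - f x\<bar>) \<partial>circle_measure) \<noteq> \<infinity>"
    using w(2) by (auto simp: top_unique)
  then have "AE x in circle_measure. (\<Sum>n. ennreal \<bar>u n x - f x\<bar>) \<noteq> \<infinity>"
    by (intro nn_integral_noteq_infinite) measurable
  then show ?thesis
  proof eventually_elim
    case (elim x)
    then have "summable (\<lambda>n. \<bar>u n x - f x\<bar>)"
      by (intro summable_suminf_not_top) auto
    then have "(\<lambda>n. \<bar>u n x - f x\<bar>) \<longlonglongrightarrow> 0" by (rule summable_LIMSEQ_zero)
    then show ?case by (simp add: tendsto_rabs_zero_iff LIM_zero_iff)
  qed
qed

text \<open>This treats one exponent and one sequence. The bounds \<open>A\<close> and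
  \<open>W\<close> are abstract so that the factor \<open>\<psi> p\<close> can be absorbed into
  them; if \<open>A\<close> or the series is infinite, the claim is trivial.\<close>

lemma Lp_norm_le_series:
  fixes F :: "real \<Rightarrow> real" and m :: "nat \<Rightarrow> nat" and W :: "nat \<Rightarrow> ennreal"
  assumes [measurable]: "F \<in> borel_measurable borel" and per: "periodic F"
    and p: "1 \<le> p" "p < q" and m: "m 0 = 1" "strict_mono m"
    and A: "Lp_norm p F \<le> A"
    and W: "\<And>k h. \<bar>h\<bar> \<le> 1 / real (m k) \<Longrightarrow> Lp_norm p (\<lambda>x. F (x + h) - F x) \<le> W k"
  shows "Lp_norm q F \<le> 6 * (A + 32 * (\<Sum>k. ennreal (real (m (Suc k)) powr (1 / p - 1 / q)) * W k))"
    (is "_ \<le> 6 * (A + 32 * ?S)")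
proof (cases "A < top \<and> ?S < top")
  case False
  then have "6 * (A + 32 * ?S) = top"
    by (auto simp: less_top[symmetric] ennreal_mult_eq_top_iff)
  then show ?thesis by (metis top_greatest)
next
  case True
  define e where "e = 1 / p - 1 / q"
  define c where "c k = real (m (Suc k)) powr e" for k
  have e: "0 \<le> e" "e \<le> 1"
  proof -
    show "0 \<le> e" using p by (simp add: e_def frac_le)
    have "1 / p \<le> 1" "0 \<le> 1 / q" using p by auto
    then show "e \<le> 1" unfolding e_def by linarith
  qed
  have m1: "1 \<le> m k" for k
    using m strict_mono_leD[OF m(2), of 0 k] by simp
  \<comment> \<open>Weights of at least 1 make the unweighted sum of the \<open>W k\<close> finite
    too, as almost everywhere convergence demands.\<close>
  have c1: "1 \<le> c k" for k
    using m1[of "Suc k"] e by (auto simp: c_def intro: ge_one_powr_ge_zero)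
  have S: "?S = (\<Sum>k. ennreal (c k) * W k)" by (simp add: c_def e_def)
  have W_le: "W k \<le> ennreal (c k) * W k" for k
  proof -
    have "ennreal 1 * W k \<le> ennreal (c k) * W k"
      using c1[of k] by (intro mult_right_mono ennreal_leI) auto
    then show ?thesis by simp
  qed
  have "(\<Sum>k. W k) \<le> ?S"
    unfolding S by (intro suminf_le W_le summableI)
  then have sumW: "(\<Sum>k. W k) < top"
    using True by (auto intro: order_le_less_trans)
  have "W k < top" for k
  proof -
    have "W k \<le> (\<Sum>k. W k)" using sum_le_suminf[OF summableI, of "{k}" W] by simp
    then show ?thesis using sumW by (rule order_le_less_trans)
  qed
  then have "\<exists>w. 0 \<le> w \<and> W k = ennreal w" for k
    by (metis ennreal_cases less_irrefl)
  then obtain w where w: "\<And>k. 0 \<le> w k" "\<And>k. W k = ennreal (w k)" by metis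
  obtain a where a: "0 \<le> a" "A = ennreal a"
    using True by (cases A) auto
  have fin: "Lp_norm p F < top" using A True by (auto intro: order_le_less_trans)
  define r where "r k = 1 / real (m k)" for k
  have r: "0 < r k" "r k \<le> 1" "r k \<le> pi" "r (Suc k) \<le> r k" for k
  proof -
    show "0 < r k" "r k \<le> 1" using m1[of k] by (auto simp: r_def)
    then show "r k \<le> pi" using pi_ge_two by linarith
    have "m k \<le> m (Suc k)" using m(2) by (simp add: strict_mono_less_eq)
    then show "r (Suc k) \<le> r k" using m1[of k] by (auto simp: r_def intro!: frac_le)
  qed
  define u where "u k = avg (r k) F" for k
  have u_borel [measurable]: "u k \<in> borel_measurable borel" for k
    unfolding u_def by (rule measurable_avg) (use r in auto)
  have u_circle [measurable]: "u k \<in> borel_measurable circle_measure" for k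
    by (rule borel_measurable_circle) measurable
  \<comment> \<open>Here \<open>e \<le> 1\<close> enters. The first average tolerates any bound up
    to 6, the differences any bound up to 96, since \<open>2 * 96 = 6 * 32\<close>.\<close>
  have pie: "pi powr e \<le> 4"
  proof -
    have "pi powr e \<le> pi powr 1" using e pi_ge_two by (intro powr_mono) auto
    then show ?thesis using pi_less_4 by simp
  qed
  have first: "Lp_norm q (u 0) \<le> ennreal (6 * a)"
  proof -
    have "Lp_norm q (u 0) \<le> ennreal ((pi / r 0) powr (1 / p - 1 / q) * a)"
      unfolding u_def by (rule Lp_norm_avg_smoothing) (use per p r a A in auto)
    also have "\<dots> \<le> ennreal (6 * a)"
      using pie a(1) m by (intro ennreal_leI mult_right_mono) (auto simp: r_def e_def)
    finally show ?thesis .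
  qed
  \<comment> \<open>The weight comes from the smaller radius \<open>r (Suc k)\<close>, the modulus
    from the larger radius \<open>r k\<close>; hence the offset between the indices of
    \<open>c\<close> and \<open>w\<close> in terms of \<open>m\<close>.\<close>
  have step: "Lp_norm q (\<lambda>x. u (Suc k) x - u k x) \<le> ennreal (192 * (c k * w k))" for k
  proof -
    have "Lp_norm q (\<lambda>x. u (Suc k) x - u k x)
        \<le> ennreal (2 * (pi / r (Suc k)) powr (1 / p - 1 / q) * w k)"
      unfolding u_def
      by (rule Lp_norm_avg_step) (use per p r w W[of _ k] fin in \<open>auto simp: r_def\<close>)
    also have "(pi / r (Suc k)) powr (1 / p - 1 / q) = pi powr e * c k"
      by (simp add: r_def e_def[symmetric] c_def powr_mult)
    also have "ennreal (2 * (pi powr e * c k) * w k) \<le> ennreal (192 * (c k * w k))"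
    proof (rule ennreal_leI)
      have "pi powr e * (c k * w k) \<le> 96 * (c k * w k)"
        using pie c1[of k] w(1)[of k] by (intro mult_right_mono) auto
      then show "2 * (pi powr e * c k) * w k \<le> 192 * (c k * w k)" by (simp add: mult_ac)
    qed
    finally show ?thesis .
  qed
  have bound: "Lp_norm q (u n) \<le> 6 * (A + 32 * ?S)" for n
  proof -
    have "u n x = u 0 x + (\<Sum>k<n. u (Suc k) x - u k x)" for x
      using sum_lessThan_telescope[of "\<lambda>k. u k x" n] by simp
    then have "u n = (\<lambda>x. u 0 x + (\<Sum>k<n. u (Suc k) x - u k x))"
      by (rule ext)
    then have "Lp_norm q (u n) = Lp_norm q (\<lambda>x. u 0 x + (\<Sum>k<n. u (Suc k) x - u k x))"
      by (rule arg_cong)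
    also have "\<dots> \<le> Lp_norm q (u 0) + Lp_norm q (\<lambda>x. \<Sum>k<n. u (Suc k) x - u k x)"
      using p by (intro Lp_norm_triangle) auto
    also have "\<dots> \<le> ennreal (6 * a) + (\<Sum>k<n. Lp_norm q (\<lambda>x. u (Suc k) x - u k x))"
      using p by (intro add_mono first Lp_norm_sum_le) auto
    also have "\<dots> \<le> ennreal (6 * a) + (\<Sum>k<n. ennreal (192 * (c k * w k)))"
      by (intro add_left_mono sum_mono step)
    also have "(\<Sum>k<n. ennreal (192 * (c k * w k))) = 192 * (\<Sum>k<n. ennreal (c k) * W k)"
      using w c1 by (simp add: sum_distrib_left ennreal_mult' order_trans[OF zero_le_one])
    also have "\<dots> \<le> 192 * ?S"
      unfolding S by (intro mult_left_mono sum_le_suminf summableI) auto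
    also have "ennreal (6 * a) + 192 * ?S = 6 * (A + 32 * ?S)"
      using a by (simp add: ennreal_mult' distrib_left mult.assoc[symmetric])
    finally show ?thesis by (simp add: add_left_mono)
  qed
  define T where "T = 6 * (A + 32 * ?S)"
  have "T < top"
    using True by (simp add: T_def ennreal_mult_less_top)
  then have T: "ennreal (enn2real T) = T" by (rule ennreal_enn2real)
  \<comment> \<open>Convergence is obtained in \<open>L_1\<close>, whose norm is dominated by the
    \<open>L_p\<close> norm, where the distance of \<open>u k\<close> from \<open>F\<close> is at
    most \<open>w k\<close>.\<close>
  have lim: "AE x in circle_measure. (\<lambda>k. u k x) \<longlonglongrightarrow> F x"
  proof (rule AE_tendsto_of_summable_L1[where w = w])
    show "F \<in> borel_measurable circle_measure" by (rule borel_measurable_circle) measurable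
    show "Lp_norm 1 (\<lambda>x. u k x - F x) \<le> ennreal (w k)" for k
    proof -
      have "Lp_norm 1 (\<lambda>x. u k x - F x) \<le> Lp_norm p (\<lambda>x. u k x - F x)"
        by (intro Lp_norm_mono_exponent borel_measurable_circle) (use p in auto)
      also have "\<dots> \<le> ennreal (w k)"
        unfolding u_def
        by (rule Lp_norm_avg_diff_le)
           (use per p r w W[of _ k] integrable_window[OF assms(1) per r(1,3) p(1) fin] in \<open>auto simp: r_def\<close>)
      finally show ?thesis .
    qed
  qed (use w sumW in auto)
  have "Lp_norm q F \<le> ennreal (enn2real T)"
  proof (rule Lp_norm_Fatou[OF u_circle _ _ _ lim])
    show "Lp_norm q (u n) \<le> ennreal (enn2real T)" for n
      unfolding T using bound[of n] by (simp only: T_def)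
  qed (use p in auto)
  then show ?thesis by (simp only: T) (simp only: T_def)
qed

text \<open>A Lebesgue measurable function agrees almost everywhere with a Borel function
  \<open>g\<close>; composing \<open>g\<close> with the remainder modulo \<open>2*pi\<close> makes
  it periodic. Shifts become ordinary translations, up to null sets depending on
  \<open>h\<close>.\<close>

lemma ex_borel_periodic_version:
  assumes "f \<in> borel_measurable circle_measure"
  obtains F where "F \<in> borel_measurable borel" "periodic F"
    "\<And>h. AE x in circle_measure. shift h f x = F (x + h)"
    "AE x in circle_measure. f x = F x"
proof -
  have "f \<in> borel_measurable (lebesgue_on {0..2*pi})"
    using assms by (simp add: measurable_cong_sets[OF sets_circle refl])
  then have "(\<lambda>x. indicator {0..2*pi} x *\<^sub>R f x) \<in> borel_measurable lebesgue"
    by (subst (asm) borel_measurable_restrict_space_iff) auto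
  then obtain g where g [measurable]: "g \<in> borel_measurable lborel"
    and eq: "AE x in lborel. indicator {0..2*pi} x *\<^sub>R f x = g x"
    using completion_ex_borel_measurable_real by blast
  obtain N where N: "{x \<in> space lborel. \<not> (indicator {0..2*pi} x *\<^sub>R f x = g x)} \<subseteq> N"
      "emeasure lborel N = 0" and N_sets [measurable]: "N \<in> sets lborel"
    using eq by (rule AE_E)
  have fg: "f x = g x" if "x \<notin> N" "x \<in> {0..2*pi}" for x
  proof (rule ccontr)
    assume "f x \<noteq> g x"
    then have "x \<in> {x \<in> space lborel. \<not> (indicator {0..2*pi} x *\<^sub>R f x = g x)}"
      using that(2) by auto
    then show False using N(1) that(1) by blast
  qed
  have AE_N: "AE x in lborel. x \<notin> N"
    by (rule AE_I[of _ _ N]) (use N(2) N_sets in auto)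
  define F where "F x = g (x rmod (2*pi))" for x
  have shift: "AE x in lborel. shift h f x = F (x + h)" for h
  proof -
    \<comment> \<open>The reduced argument is one of countably many translates of \<open>x\<close>,
      and for almost every \<open>x\<close> all of them avoid the null set \<open>N\<close>.\<close>
    have "AE x in lborel. (h - 2 * pi * of_int k) + 1 * x \<notin> N" for k :: int
      using AE_N by (intro AE_borel_affine) auto
    then have "AE x in lborel. \<forall>k::int. (h - 2 * pi * of_int k) + 1 * x \<notin> N"
      by (simp add: AE_all_countable)
    then show ?thesis
    proof eventually_elim
      case (elim x)
      have "(x + h) rmod (2*pi) = (h - 2 * pi * of_int \<lfloor>(x + h) / (2*pi)\<rfloor>) + 1 * x"
        by (simp add: rmod_def)
      then have "(x + h) rmod (2*pi) \<notin> N" using elim by metis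
      then show ?case
        unfolding shift_def F_def by (intro fg) (auto simp: rmod_nonneg rmod_le)
    qed
  qed
  show thesis
  proof (rule that[of F])
    show "F \<in> borel_measurable borel"
      unfolding F_def rmod_def by measurable
    show "periodic F"
      by (simp add: periodic_def F_def rmod_def add_divide_distrib algebra_simps)
    show "AE x in circle_measure. shift h f x = F (x + h)" for h
      using shift[of h] by (intro AE_circle) auto
    show "AE x in circle_measure. f x = F x"
    proof (rule AE_circle)
      \<comment> \<open>The endpoint reduces to 0, where \<open>f\<close> may have a different
        value.\<close>
      have ne: "AE x in lborel. x \<noteq> 2 * pi" by (rule AE_lborel_singleton)
      show "AE x in lborel. x \<in> {0..2*pi} \<longrightarrow> f x = F x"
        using shift[of 0] ne
      proof eventually_elim
        case (elim x)
        show ?case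
        proof
          assume "x \<in> {0..2*pi}"
          then have "x rmod (2*pi) = x"
            using elim by (intro rmod_unique[where n = 0]) auto
          then show "f x = F x" using elim by (simp add: shift_def)
        qed
      qed
    qed
  qed
qed

section \<open>Comparison with the grand Lebesgue norm and its modulus of continuity\<close>

lemma Lp_norm_le_gls_norm:
  assumes "p \<in> einterval 1 b" "0 < \<psi> p"
  shows "Lp_norm p f \<le> ennreal (\<psi> p) * gls_norm b (\<lambda>p. ennreal (\<psi> p)) f"
proof -
  have c: "ennreal (\<psi> p) * (Lp_norm p f / ennreal (\<psi> p)) = Lp_norm p f"
    using assms(2) mult_divide_eq_ennreal[of "ennreal (\<psi> p)" "Lp_norm p f"]
    by (simp add: ennreal_times_divide mult.commute)
  have "Lp_norm p f / ennreal (\<psi> p) \<le> gls_norm b (\<lambda>p. ennreal (\<psi> p)) f"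
    unfolding gls_norm_def by (rule SUP_upper[OF assms(1)])
  then show ?thesis using mult_left_mono c by (metis zero_le)
qed

text \<open>The two infima are removed first. For \<open>p < q\<close> the series estimate is
  applied to a periodic version of \<open>f\<close>, with the norm and the moduli multiplied by
  \<open>\<psi> p\<close>.\<close>

lemma Lp_norm_le_theta:
  fixes b :: ereal and \<psi> f :: "real \<Rightarrow> real"
  assumes \<psi>: "\<And>p. p \<in> einterval 1 b \<Longrightarrow> 0 < \<psi> p"
    and f: "f \<in> borel_measurable circle_measure" and q: "1 < q"
  shows "Lp_norm q f \<le> 6 * theta b \<psi> f q"
  unfolding theta_def
proof (rule ennreal_le_mult_INF)
  fix p assume pb: "p \<in> einterval 1 b"
  then have p: "1 \<le> p" by (auto simp: einterval_def one_ereal_def)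
  note \<psi>p = \<psi>[OF pb]
  let ?\<psi> = "\<lambda>p. ennreal (\<psi> p)"
  let ?N = "gls_norm b ?\<psi> f"
  let ?\<omega> = "gls_modulus b ?\<psi> f"
  have "Lp_norm q f \<le> (6 * ennreal (\<psi> p)) *
     (INF n\<in>Zseq. ?N + 32 * (\<Sum>k. ennreal (real (n (k + 2)) powr (1 / p - 1 / q)) * ?\<omega> (1 / real (n (k + 1)))))"
  proof (rule ennreal_le_mult_INF)
    fix n assume n: "n \<in> Zseq"
    let ?S = "\<Sum>k. ennreal (real (n (k + 2)) powr (1 / p - 1 / q)) * ?\<omega> (1 / real (n (k + 1)))"
    have "Lp_norm q f \<le> 6 * (ennreal (\<psi> p) * (?N + 32 * ?S))"
    proof (cases "q \<le> p")
      case True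
      \<comment> \<open>For \<open>q \<le> p\<close> the first summand alone suffices; the series
        only enlarges the bound.\<close>
      have "Lp_norm q f \<le> Lp_norm p f"
        using f q True by (intro Lp_norm_mono_exponent) auto
      also have "\<dots> \<le> ennreal (\<psi> p) * ?N" by (rule Lp_norm_le_gls_norm[where \<psi> = \<psi>, OF pb \<psi>p])
      also have "\<dots> \<le> ennreal (\<psi> p) * (?N + 32 * ?S)" by (intro mult_left_mono) auto
      also have "\<dots> = 1 * (ennreal (\<psi> p) * (?N + 32 * ?S))" by simp
      also have "\<dots> \<le> 6 * (ennreal (\<psi> p) * (?N + 32 * ?S))"
        by (rule mult_right_mono) auto
      finally show ?thesis .
    next
      case False
      obtain F where F: "F \<in> borel_measurable borel" "periodic F"
        "\<And>h. AE x in circle_measure. shift h f x = F (x + h)"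
        "AE x in circle_measure. f x = F x"
        using f by (rule ex_borel_periodic_version) blast
      \<comment> \<open>Re-indexing from 0 discards the arbitrary value \<open>n 0\<close> and turns
        \<open>n 1 = 1\<close> into \<open>m 0 = 1\<close>.\<close>
      define m where "m k = n (Suc k)" for k
      have m: "m 0 = 1" "strict_mono m"
        using n by (auto simp: m_def Zseq_def strict_mono_Suc_iff strict_mono_on_def)
      have "Lp_norm q f = Lp_norm q F" by (rule Lp_norm_cong_AE[OF F(4)])
      also have "\<dots> \<le> 6 * (ennreal (\<psi> p) * ?N + 32 *
          (\<Sum>k. ennreal (real (m (Suc k)) powr (1 / p - 1 / q)) * (ennreal (\<psi> p) * ?\<omega> (1 / real (m k)))))"
      proof (rule Lp_norm_le_series[OF F(1,2) p _ m])
        show "p < q" using False by simp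
        show "Lp_norm p F \<le> ennreal (\<psi> p) * ?N"
          using Lp_norm_le_gls_norm[where \<psi> = \<psi>, OF pb \<psi>p, of f] Lp_norm_cong_AE[OF F(4), of p] by simp
        fix k h assume h: "\<bar>h\<bar> \<le> 1 / real (m k)"
        \<comment> \<open>The supremum in \<open>gls_modulus\<close> only admits shifts shorter than
          a period, which radii up to 1 guarantee.\<close>
        have "1 / real (m k) \<le> 1"
          using strict_mono_leD[OF m(2), of 0 k] m(1) by simp
        then have "\<bar>h\<bar> < 2 * pi" using h pi_ge_two by linarith
        then have hs: "h \<in> {h \<in> {-2 * pi<..<2 * pi}. \<bar>h\<bar> \<le> 1 / real (m k)}" using h by auto
        have "AE x in circle_measure. F (x + h) - F x = shift h f x - f x"
          using F(3)[of h] F(4) by eventually_elim simp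
        then have "Lp_norm p (\<lambda>x. F (x + h) - F x) = Lp_norm p (\<lambda>x. shift h f x - f x)"
          by (rule Lp_norm_cong_AE)
        also have "\<dots> \<le> ennreal (\<psi> p) * gls_norm b ?\<psi> (\<lambda>x. shift h f x - f x)"
          by (rule Lp_norm_le_gls_norm[where \<psi> = \<psi>, OF pb \<psi>p])
        also have "\<dots> \<le> ennreal (\<psi> p) * ?\<omega> (1 / real (m k))"
          unfolding gls_modulus_def by (intro mult_left_mono SUP_upper[OF hs]) auto
        finally show "Lp_norm p (\<lambda>x. F (x + h) - F x) \<le> ennreal (\<psi> p) * ?\<omega> (1 / real (m k))" .
      qed
      also have "(\<Sum>k. ennreal (real (m (Suc k)) powr (1 / p - 1 / q)) * (ennreal (\<psi> p) * ?\<omega> (1 / real (m k))))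
          = ennreal (\<psi> p) * ?S"
        by (simp add: m_def mult.left_commute ennreal_suminf_cmult)
      also have "6 * (ennreal (\<psi> p) * ?N + 32 * (ennreal (\<psi> p) * ?S)) = 6 * (ennreal (\<psi> p) * (?N + 32 * ?S))"
        by (simp add: distrib_left mult.left_commute)
      finally show ?thesis .
    qed
    then show "Lp_norm q f \<le> (6 * ennreal (\<psi> p)) * (?N + 32 * ?S)"
      by (simp add: mult.assoc)
  qed (use \<psi>p in \<open>auto simp: ennreal_mult_less_top ennreal_zero_less_mult_iff\<close>)
  then show "Lp_norm q f \<le> 6 * nu b \<psi> f q p"
    by (simp add: nu_def mult.assoc)
qed auto

theorem theorem1:
  fixes b b1 :: ereal and \<psi> f :: "real \<Rightarrow> real"
  assumes "1 < b"
    and "\<psi> \<in> Psi b"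
    and "f \<in> gls b (\<lambda>p. ennreal (\<psi> p))"
    and "b \<le> b1"
    and "\<forall>q\<in>einterval 1 b1. theta b \<psi> f q < \<infinity>"
  shows "(\<forall>q\<in>einterval 1 b1. Lp_norm q f \<le> 6 * theta b \<psi> f q) \<and>
         gls_norm b1 (theta b \<psi> f) f \<le> 6"
proof (intro conjI ballI)
  show le: "Lp_norm q f \<le> 6 * theta b \<psi> f q" if "q \<in> einterval 1 b1" for q
  proof (rule Lp_norm_le_theta)
    show "0 < \<psi> p" if "p \<in> einterval 1 b" for p
      using assms(2) that by (simp add: Psi_def)
    show "f \<in> borel_measurable circle_measure" using assms(3) by (simp add: gls_def)
    show "1 < q" using that by (auto simp: einterval_def one_ereal_def)
  qed
  show "gls_norm b1 (theta b \<psi> f) f \<le> 6"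
    unfolding gls_norm_def
  proof (rule SUP_least)
    fix q assume q: "q \<in> einterval 1 b1"
    show "Lp_norm q f / theta b \<psi> f q \<le> 6"
    proof (cases "theta b \<psi> f q = 0")
      case True
      \<comment> \<open>Here the norm vanishes as well, and the quotient \<open>0 / 0\<close> is 0.
        In the other case finiteness of \<open>theta\<close> allows cancellation.\<close>
      then show ?thesis using le[OF q] by simp
    next
      case False
      then have "6 * theta b \<psi> f q / theta b \<psi> f q = 6"
        using assms(5) q by (intro mult_divide_eq_ennreal) auto
      then show ?thesis
        using divide_right_mono_ennreal[OF le[OF q], of "theta b \<psi> f q"] by simp
    qed
  qed
qed

end
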